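(* Let $\Lambda\subset\mathbb R^d$ be a Bravais lattice and let $G=(V,E,K,s,t)$ be a (finite) series-parallel two-terminal weighted multigraph with kernels $K_e\in\ell^1(\Lambda)$ for all $e\in E$. Then its graph lattice sum $\mathcal Z_G$ can be generated, starting from the graph lattice sums of its $|E|$ edges, each viewed as a bridge with terminals its endpoints, using exactly 1. $|V|-2$ pairwise (pointwise) multiplications, 2. $|E|-|V|+1$ convolutions, leading to a total of $|E|-1$ operations. If $s=t$, one additional zero-momentum evaluation is required.
   Context: Lattice: $\Lambda=A\mathbb Z^d$ with $A\in\mathbb R^{d\times d}$ invertible, $V_\Lambda=|\det A|$, $\mathrm{BZ}=A^{-T}[0,1)^d$. Two-terminal weighted multigraph $G=(V,E,K,s,t)$: each edge $e$ has tail $e^-$ and head $e^+$ in $V$ with $e^-\ne e^+$ (parallel edges allowed), a kernel $K_e:\Lambda\to\mathbb C$; $s,t\in V$ are the terminals. For $G$ finite and connected with $K_e\in\ell^1(\Lambda)$ the graph lattice sum is $$\mathcal Z_G(\boldsymbol k)=\sum_{\{\boldsymbol x_v\in\Lambda\}_{v\neq p}}e^{-2\pi i(\boldsymbol x_t-\boldsymbol x_s)\cdot\boldsymbol k}\prod_{e\in E}K_e(\boldsymbol x_{e^+}-\boldsymbol x_{e^-}),\qquad\boldsymbol k\in\mathrm{BZ},$$ with an arbitrary pinning node $p\in V$ whose position is held fixed in $\Lambda$ (the value depends neither on $p$ nor on its position). It is extended $A^{-T}\mathbb Z^d$-periodically to $\mathbb R^d$. A single edge $e$ viewed as a bridge is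 the two-node, one-edge graph with node set $\{e^-,e^+\}$, kernel $K_e$, and terminals its two endpoints, taken in the order required by the composition; its graph lattice sum is $\hat K_e(\boldsymbol k)=\sum_{\boldsymbol x\in\Lambda}e^{-2\pi i\boldsymbol x\cdot\boldsymbol k}K_e(\boldsymbol x)$ for terminals $(e^-,e^+)$, and that of $K_e(-\,\cdot\,)$ for terminals $(e^+,e^-)$. Operations on functions on $\mathrm{BZ}$: pointwise multiplication $f\,g$; convolution $(f\ast g)(\boldsymbol k)=V_\Lambda\int_{\mathrm{BZ}}f(\boldsymbol k-\boldsymbol p)g(\boldsymbol p)\,\mathrm d\boldsymbol p$ (with periodic extension); zero-momentum evaluation $f(\boldsymbol k)\leftarrow f(\boldsymbol 0)$. "Generated" means: starting with the collection of the $|E|$ bridge functions, each multiplication or convolution replaces two members of the current collection by their product or convolution, until one function remains (to which, if $s=t$, a zero-momentum evaluation is applied as final operation). Series-parallel (edge orientations are disregarded): (1) a graph with only two distinct nodes $s,t$ and a single edge between them, with terminals $s,t$, is series-parallel; (2) if $G_1,G_2$ (with terminals $(s_1,t_1)$, $(s_2,t_2)$) are series-parallel, then, after taking the disjoint union, so are the series composition (identify $t_1$ with $s_2$, new terminals $(s_1,t_2)$) and the parallel composition (identify $s_1$ with $s_2$ and $t_1$ with $t_2$, which become the terminals); (3) a graph without terminals, or equivalently with equal terminals $s=t$, is called series-parallel if it can be equipped with two distinct terminals such that the resulting two-terminal graph is series-parallel. *)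

theory Defs
  imports "HOL-Analysis.Analysis" "Graph_Theory.Digraph"
begin

section \<open>Bravais lattices\<close>

definition bravais_lattice :: "real^'n^'n \<Rightarrow> (real^'n) set" where
  "bravais_lattice A = (\<lambda>z. A *v z) ` {z. \<forall>i. z $ i \<in> \<int>}"

definition cell_volume :: "real^'n^'n \<Rightarrow> real" where
  "cell_volume A = \<bar>det A\<bar>"

definition brillouin_zone :: "real^'n^'n \<Rightarrow> (real^'n) set" where
  "brillouin_zone A = (\<lambda>u. matrix_inv (transpose A) *v u) ` {u. \<forall>i. 0 \<le> u $ i \<and> u $ i < 1}"

definition reciprocal_lattice :: "real^'n^'n \<Rightarrow> (real^'n) set" where
  "reciprocal_lattice A = bravais_lattice (matrix_inv (transpose A))"


section \<open>Two-terminal weighted multigraphs and graph lattice sums\<close>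

text \<open>The terminals may coincide. Only the values of the kernels on the lattice matter.\<close>

record ('v, 'e, 'n) network =
  multigraph :: "('v, 'e) pre_digraph"
  kernel :: "'e \<Rightarrow> real^'n \<Rightarrow> complex"
  source :: 'v
  sink :: 'v

definition finite_network :: "('v, 'e, 'n::finite) network \<Rightarrow> bool" where
  "finite_network G \<longleftrightarrow>
     fin_digraph (multigraph G) \<and> loopfree_digraph (multigraph G) \<and>
     source G \<in> verts (multigraph G) \<and> sink G \<in> verts (multigraph G)"

definition summable_kernels :: "real^'n^'n \<Rightarrow> ('v, 'e, 'n::finite) network \<Rightarrow> bool" where
  "summable_kernels A G \<longleftrightarrow>
     (\<forall>e\<in>arcs (multigraph G). (\<lambda>x. norm (kernel G e x)) summable_on bravais_lattice A)"

text \<open>The summation is over all placements of the nodes in the lattice for which the pinning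
  node \<open>p\<close> sits at \<open>a\<close>.\<close>

definition pinned_lattice_sum ::
    "real^'n^'n \<Rightarrow> ('v, 'e, 'n::finite) network \<Rightarrow> 'v \<Rightarrow> real^'n \<Rightarrow> real^'n \<Rightarrow> complex" where
  "pinned_lattice_sum A G p a k =
     (\<Sum>\<^sub>\<infinity>x \<in> (\<Pi>\<^sub>E v\<in>verts (multigraph G). if v = p then {a} else bravais_lattice A).
        exp (- 2 * complex_of_real pi * \<i> * complex_of_real ((x (sink G) - x (source G)) \<bullet> k)) *
        (\<Prod>e\<in>arcs (multigraph G).
           kernel G e (x (head (multigraph G) e) - x (tail (multigraph G) e))))"

text \<open>The pin is placed at one terminal, at the origin; lemma \<open>graph_lattice_sum_pin\<close> below shows
  that neither choice matters. The formula makes sense for every momentum and is the periodic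
  extension of its restriction to the Brillouin zone, see \<open>graph_lattice_sum_periodic\<close>. Thus
  functions on the Brillouin zone are represented by their periodic extensions.\<close>

definition graph_lattice_sum ::
    "real^'n^'n \<Rightarrow> ('v, 'e, 'n::finite) network \<Rightarrow> real^'n \<Rightarrow> complex" where
  "graph_lattice_sum A G = pinned_lattice_sum A G (source G) 0"

definition bridge :: "('v, 'e, 'n::finite) network \<Rightarrow> 'e \<Rightarrow> 'v \<times> 'v \<Rightarrow> ('v, 'e, 'n) network" where
  "bridge G e st =
     \<lparr> multigraph = \<lparr> verts = {tail (multigraph G) e, head (multigraph G) e}, arcs = {e},
                     tail = tail (multigraph G), head = head (multigraph G) \<rparr>,
       kernel = kernel G, source = fst st, sink = snd st \<rparr>"

lemma bravais_lattice_0: "0 \<in> bravais_lattice A"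
  unfolding bravais_lattice_def by (rule image_eqI[of _ _ 0]) auto

lemma bravais_lattice_add:
  assumes "x \<in> bravais_lattice A" "y \<in> bravais_lattice A"
  shows "x + y \<in> bravais_lattice A"
proof -
  obtain u v where "x = A *v u" "y = A *v v" "\<forall>i. u $ i \<in> \<int>" "\<forall>i. v $ i \<in> \<int>"
    using assms by (auto simp: bravais_lattice_def)
  then show ?thesis
    unfolding bravais_lattice_def
    by (intro image_eqI[of _ _ "u + v"]) (auto simp: matrix_vector_right_distrib)
qed

lemma bravais_lattice_diff:
  assumes "x \<in> bravais_lattice A" "y \<in> bravais_lattice A"
  shows "x - y \<in> bravais_lattice A"
proof -
  obtain u v where "x = A *v u" "y = A *v v" "\<forall>i. u $ i \<in> \<int>" "\<forall>i. v $ i \<in> \<int>"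
    using assms by (auto simp: bravais_lattice_def)
  then show ?thesis
    unfolding bravais_lattice_def
    by (intro image_eqI[of _ _ "u - v"]) (auto simp: matrix_vector_mult_diff_distrib)
qed

lemma pinned_lattice_sum_pin:
  assumes wf: "wf_digraph (multigraph G)"
    and st: "source G \<in> verts (multigraph G)" "sink G \<in> verts (multigraph G)"
    and p: "p \<in> verts (multigraph G)" "q \<in> verts (multigraph G)"
    and ab: "a \<in> bravais_lattice A" "b \<in> bravais_lattice A"
  shows "pinned_lattice_sum A G p a k = pinned_lattice_sum A G q b k"
proof -
  let ?V = "verts (multigraph G)"
  let ?S = "\<lambda>p a. \<Pi>\<^sub>E v\<in>?V. if v = p then {a} else bravais_lattice A"
  let ?h = "\<lambda>q b x. restrict (\<lambda>v. x v - x q + b) ?V"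
  have lat: "x v \<in> bravais_lattice A"
    if "x \<in> ?S p a" "v \<in> ?V" "a \<in> bravais_lattice A" for x p a v
    using PiE_mem[OF that(1,2)] that(3) by (auto split: if_splits)
  have pin: "x p = a" if "x \<in> ?S p a" "p \<in> ?V" for x p a
    using PiE_mem[OF that] by auto
  have inv: "?h p a (?h q b x) = x"
    if "x \<in> ?S p a" "p \<in> ?V" "q \<in> ?V" for x p a q b
    using that pin[OF that(1,2)] by (auto simp: fun_eq_iff PiE_def extensional_def)
  have into: "?h q b x \<in> ?S q b"
    if "x \<in> ?S p a" "q \<in> ?V" "a \<in> bravais_lattice A" "b \<in> bravais_lattice A" for x p a q b
    using lat[OF that(1) _ that(3)] that(2,4)
    by (auto intro!: bravais_lattice_add bravais_lattice_diff)
  show ?thesis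
    unfolding pinned_lattice_sum_def
  proof (rule infsum_reindex_bij_witness[where i = "?h p a" and j = "?h q b"])
    fix x assume x: "x \<in> ?S p a"
    have ends: "tail (multigraph G) e \<in> ?V" "head (multigraph G) e \<in> ?V"
      if "e \<in> arcs (multigraph G)" for e
      using wf that by (auto simp: wf_digraph_def)
    show "exp (- 2 * complex_of_real pi * \<i> *
          complex_of_real ((?h q b x (sink G) - ?h q b x (source G)) \<bullet> k)) *
        (\<Prod>e\<in>arcs (multigraph G).
          kernel G e (?h q b x (head (multigraph G) e) - ?h q b x (tail (multigraph G) e))) =
        exp (- 2 * complex_of_real pi * \<i> * complex_of_real ((x (sink G) - x (source G)) \<bullet> k)) *
        (\<Prod>e\<in>arcs (multigraph G).
          kernel G e (x (head (multigraph G) e) - x (tail (multigraph G) e)))"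
      using st by (intro arg_cong2[of _ _ _ _ "(*)"] prod.cong) (auto simp: ends)
    show "?h p a (?h q b x) = x" using inv x p by blast
    show "?h q b x \<in> ?S q b" by (rule into[OF x p(2) ab])
  next
    fix y assume y: "y \<in> ?S q b"
    show "?h q b (?h p a y) = y" using inv y p by blast
    show "?h p a y \<in> ?S p a" by (rule into[OF y p(1) ab(2,1)])
  qed
qed

lemma graph_lattice_sum_pin:
  assumes "finite_network G" "p \<in> verts (multigraph G)" "a \<in> bravais_lattice A"
  shows "graph_lattice_sum A G k = pinned_lattice_sum A G p a k"
  using assms unfolding graph_lattice_sum_def
  by (intro pinned_lattice_sum_pin)
     (auto simp: finite_network_def fin_digraph_def bravais_lattice_0)

lemma inner_lattice_reciprocal:
  assumes "invertible A" "x \<in> bravais_lattice A" "g \<in> reciprocal_lattice A"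
  shows "x \<bullet> g \<in> \<int>"
proof -
  obtain w z where w: "x = A *v w" "\<forall>i. w $ i \<in> \<int>"
    and z: "g = matrix_inv (transpose A) *v z" "\<forall>i. z $ i \<in> \<int>"
    using assms by (auto simp: bravais_lattice_def reciprocal_lattice_def)
  have inv: "transpose A ** matrix_inv (transpose A) = mat 1"
    using transpose_invertible[OF assms(1)] unfolding invertible_def matrix_inv_def
    by (rule someI2_ex) simp
  have "x \<bullet> g = w \<bullet> (transpose A *v g)"
    by (simp add: w(1) dot_lmul_matrix[of g A w] inner_commute[of w] inner_commute[of _ g])
  also have "\<dots> = w \<bullet> z"
    by (simp add: z(1) matrix_vector_mul_assoc inv)
  also have "\<dots> \<in> \<int>"
    using w z by (auto simp: inner_vec_def intro!: Ints_sum Ints_mult)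
  finally show ?thesis .
qed

lemma graph_lattice_sum_periodic:
  assumes "invertible A" "finite_network G" "g \<in> reciprocal_lattice A"
  shows "graph_lattice_sum A G (k + g) = graph_lattice_sum A G k"
  unfolding graph_lattice_sum_def pinned_lattice_sum_def
proof (intro infsum_cong arg_cong2[of _ _ _ _ "(*)"] refl)
  fix x
  assume x: "x \<in> (\<Pi>\<^sub>E v\<in>verts (multigraph G). if v = source G then {0} else bravais_lattice A)"
  have "x v \<in> bravais_lattice A" if "v \<in> verts (multigraph G)" for v
    using PiE_mem[OF x that] by (auto split: if_splits simp: bravais_lattice_0)
  then have "x (sink G) - x (source G) \<in> bravais_lattice A"
    using assms(2) by (auto simp: finite_network_def intro!: bravais_lattice_diff)
  then have "(x (sink G) - x (source G)) \<bullet> g \<in> \<int>"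
    using inner_lattice_reciprocal assms by blast
  then have "exp (2 * complex_of_real pi * \<i> *
      complex_of_real ((x (sink G) - x (source G)) \<bullet> g)) = 1"
    by (auto elim!: Ints_cases simp: exp_eq_1)
  then show "exp (- 2 * complex_of_real pi * \<i> *
        complex_of_real ((x (sink G) - x (source G)) \<bullet> (k + g))) =
      exp (- 2 * complex_of_real pi * \<i> * complex_of_real ((x (sink G) - x (source G)) \<bullet> k))"
    by (simp add: inner_add_right distrib_left exp_diff exp_add exp_minus)
qed


section \<open>Series-parallel graphs\<close>

text \<open>A two-terminal graph with node set \<open>V\<close>, edge set \<open>E\<close> and terminals \<open>s, t\<close>, edge \<open>e\<close>
  having the (unordered) set of endpoints \<open>ends e\<close>. The compositions are internal: instead of
  gluing disjoint copies, the components are subgraphs that share exactly the identified nodes.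
  This is the same up to isomorphism, and the notion is isomorphism invariant by
  \<open>series_parallel_between_iso\<close>.\<close>

inductive series_parallel_between :: "('e \<Rightarrow> 'v set) \<Rightarrow> 'v set \<Rightarrow> 'e set \<Rightarrow> 'v \<Rightarrow> 'v \<Rightarrow> bool"
  for ends :: "'e \<Rightarrow> 'v set"
where
  single_edge: "\<lbrakk>s \<noteq> t; ends e = {s, t}\<rbrakk> \<Longrightarrow> series_parallel_between ends {s, t} {e} s t"
| series_comp: "\<lbrakk>series_parallel_between ends V1 E1 s u; series_parallel_between ends V2 E2 u t;
     V1 \<inter> V2 = {u}; E1 \<inter> E2 = {}\<rbrakk>
     \<Longrightarrow> series_parallel_between ends (V1 \<union> V2) (E1 \<union> E2) s t"
| parallel_comp: "\<lbrakk>series_parallel_between ends V1 E1 s t; series_parallel_between ends V2 E2 s t;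
     V1 \<inter> V2 = {s, t}; E1 \<inter> E2 = {}\<rbrakk>
     \<Longrightarrow> series_parallel_between ends (V1 \<union> V2) (E1 \<union> E2) s t"

lemma series_parallel_between_terminals:
  "series_parallel_between ends V E s t \<Longrightarrow> s \<in> V \<and> t \<in> V \<and> s \<noteq> t"
  by (induction rule: series_parallel_between.induct) auto

lemma series_parallel_between_iso:
  assumes "series_parallel_between ends V E s t"
    and "inj_on \<phi> V" "inj_on \<psi> E" "\<And>e. e \<in> E \<Longrightarrow> ends' (\<psi> e) = \<phi> ` ends e"
  shows "series_parallel_between ends' (\<phi> ` V) (\<psi> ` E) (\<phi> s) (\<phi> t)"
  using assms
proof (induction rule: series_parallel_between.induct)
  case (single_edge s t e)
  then show ?case
    using series_parallel_between.single_edge[of "\<phi> s" "\<phi> t" ends' "\<psi> e"] by auto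
next
  case (series_comp V1 E1 s u V2 E2 t)
  have "\<phi> ` V1 \<inter> \<phi> ` V2 = {\<phi> u}" "\<psi> ` E1 \<inter> \<psi> ` E2 = {}"
    using series_comp.hyps series_comp.prems
    by (auto simp: inj_on_image_Int[of \<phi> "V1 \<union> V2", symmetric]
        inj_on_image_Int[of \<psi> "E1 \<union> E2", symmetric])
  then show ?case
    using series_comp unfolding image_Un
    by (intro series_parallel_between.series_comp) (auto intro: inj_on_subset)
next
  case (parallel_comp V1 E1 s t V2 E2)
  have "\<phi> ` V1 \<inter> \<phi> ` V2 = {\<phi> s, \<phi> t}" "\<psi> ` E1 \<inter> \<psi> ` E2 = {}"
    using parallel_comp.hyps parallel_comp.prems
    by (auto simp: inj_on_image_Int[of \<phi> "V1 \<union> V2", symmetric]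
        inj_on_image_Int[of \<psi> "E1 \<union> E2", symmetric])
  then show ?case
    using parallel_comp unfolding image_Un
    by (intro series_parallel_between.parallel_comp) (auto intro: inj_on_subset)
qed

definition series_parallel :: "('v, 'e, 'n::finite) network \<Rightarrow> bool" where
  "series_parallel G \<longleftrightarrow>
     (let D = multigraph G;
          sp = series_parallel_between (\<lambda>e. {tail D e, head D e}) (verts D) (arcs D)
      in if source G \<noteq> sink G then sp (source G) (sink G)
         else (\<exists>s\<in>verts D. \<exists>t\<in>verts D. s \<noteq> t \<and> sp s t))"


section \<open>Generation by multiplications and convolutions\<close>

definition convolution ::
    "real^'n^'n \<Rightarrow> (real^'n \<Rightarrow> complex) \<Rightarrow> (real^'n \<Rightarrow> complex) \<Rightarrow> real^'n \<Rightarrow> complex" where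
  "convolution A f g k =
     complex_of_real (cell_volume A) * (LINT p:brillouin_zone A|lborel. f (k - p) * g p)"

definition zero_momentum :: "(real^'n \<Rightarrow> complex) \<Rightarrow> real^'n \<Rightarrow> complex" where
  "zero_momentum f k = f 0"

text \<open>\<open>generates A M m c N\<close>: the collection \<open>M\<close> of functions is turned into the collection \<open>N\<close>
  by exactly \<open>m\<close> multiplications and \<open>c\<close> convolutions.\<close>

inductive generates :: "real^'n^'n \<Rightarrow> (real^'n \<Rightarrow> complex) multiset \<Rightarrow> nat \<Rightarrow> nat \<Rightarrow>
    (real^'n \<Rightarrow> complex) multiset \<Rightarrow> bool"
  for A :: "real^'n^'n" and M :: "(real^'n \<Rightarrow> complex) multiset"
where
  start: "generates A M 0 0 M"
| multiply: "generates A M m c (N + {#f, g#}) \<Longrightarrow> generates A M (Suc m) c (N + {#\<lambda>k. f k * g k#})"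
| convolve: "generates A M m c (N + {#f, g#}) \<Longrightarrow> generates A M m (Suc c) (N + {#convolution A f g#})"

end

theory Submission
  imports Defs
begin

text \<open>
  With the source pinned at the origin, a graph lattice sum is a trigonometric series in the momentum:
  its indices are the placements of the other nodes, the coefficient of a placement is the product of
  the kernels, and the frequency is the position of the sink. The theorem rests on what the two
  operations on functions do to such series.

  A product of two absolutely convergent series runs over pairs of indices, with added frequencies
  (\<open>fourier_sum_mult\<close>). Placements of a series composition are such pairs, the second component being
  attached at the sink of the first one, and displacements add. Hence the lattice sum of a series
  composition is the product of the lattice sums (\<open>graph_lattice_sum_series\<close>).

  A convolution also runs over pairs of indices, but only over those with equal frequencies
  (\<open>fourier_sum_convolution\<close>), because lattice characters are orthogonal over the Brillouin zone
  (\<open>integral_brillouin_zone_phase\<close>). Placements of a parallel composition, with the common source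
  pinned, are the pairs that agree on the position of the common sink. Hence the lattice sum of a
  parallel composition is the convolution of the lattice sums (\<open>graph_lattice_sum_parallel\<close>).

  So a construction of \<open>G\<close> from single edges by compositions is at the same time a way of generating
  its lattice sum from bridges, one operation for each composition. The numbers follow by counting
  nodes and edges (\<open>generates_series_parallel\<close>). Absolute summability, which both rules need, is passed
  on to compositions since the sums run over subsets of products (\<open>abs_summable_weight\<close>). If the
  terminals of \<open>G\<close> coincide, the phase disappears, as it does at momentum zero for any pair of
  terminals, and the choice of the pinned node is immaterial.
\<close>

section \<open>Linear changes of variables\<close>

text \<open>Determinant and volume factor are both multiplicative, and an invertible matrix is a product of
  diagonal matrices, which stretch the axes, of transpositions, which permute the sides of a box,
  and of shears, which turn a box into a parallelepiped of the same volume.\<close>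

lemma measure_matrix_image:
  fixes B :: "real^'n^'n" and S :: "(real^'n) set"
  assumes "det B \<noteq> 0" and "S \<in> lmeasurable"
  shows "(*v) B ` S \<in> lmeasurable \<and> measure lebesgue ((*v) B ` S) = \<bar>det B\<bar> * measure lebesgue S"
proof -
  let ?Q = "\<lambda>B :: real^'n^'n. \<forall>S\<in>lmeasurable. (*v) B ` S \<in> lmeasurable \<and>
      measure lebesgue ((*v) B ` S) = \<bar>det B\<bar> * measure lebesgue S"
  have "det B \<noteq> 0 \<longrightarrow> ?Q B"
  proof (rule induct_matrix_elementary_alt)
    fix B C :: "real^'n^'n"
    assume "det B \<noteq> 0 \<longrightarrow> ?Q B" "det C \<noteq> 0 \<longrightarrow> ?Q C"
    then show "det (B ** C) \<noteq> 0 \<longrightarrow> ?Q (B ** C)"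
      unfolding det_mul matrix_vector_mult_matrix_matrix_mult_compose image_comp[symmetric]
      by (simp add: abs_mult)
  next
    fix B :: "real^'n^'n" and i
    assume "row i B = 0"
    then show "det B \<noteq> 0 \<longrightarrow> ?Q B"
      by (simp add: det_zero_row)
  next
    fix B :: "real^'n^'n"
    assume diag: "\<And>i j. i \<noteq> j \<Longrightarrow> B $ i $ j = 0"
    have "B *v x = (\<chi> k. B $ k $ k * x $ k)" for x
    proof -
      have "(\<Sum>j\<in>UNIV. B $ k $ j * x $ j) = B $ k $ k * x $ k" for k
        using diag by (subst sum.remove[of _ k]) (auto intro!: sum.neutral)
      then show ?thesis
        by (simp add: matrix_vector_mult_def)
    qed
    then show "det B \<noteq> 0 \<longrightarrow> ?Q B"
      using measurable_stretch[of _ "\<lambda>k. B $ k $ k"] measure_stretch[of _ "\<lambda>k. B $ k $ k"]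
      by (simp add: det_diagonal[OF diag])
  next
    fix m n :: 'n
    assume "m \<noteq> n"
    let ?\<tau> = "Transposition.transpose m n"
    define B :: "real^'n^'n" where "B = (\<chi> i j. mat 1 $ i $ ?\<tau> j)"
    have B: "B *v x = (\<chi> i. x $ ?\<tau> i)" for x
    proof -
      have "(\<Sum>j\<in>UNIV. mat 1 $ i $ ?\<tau> j * x $ j) = x $ ?\<tau> i" for i
        by (subst sum.remove[of _ "?\<tau> i"])
           (auto simp: mat_def transpose_eq_iff intro!: sum.neutral split: if_splits)
      then show ?thesis
        by (simp add: matrix_vector_mult_def B_def)
    qed
    have "det B = of_int (sign ?\<tau>) * det (mat 1 :: real^'n^'n)"
      unfolding B_def by (rule det_permute_columns) (simp add: permutes_swap_id)
    then have det: "\<bar>det B\<bar> = 1"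
      using \<open>m \<noteq> n\<close> by (simp add: sign_swap_id)
    have box: "(*v) B ` cbox a b = cbox (B *v a) (B *v b)" for a b
    proof -
      have "x \<in> (*v) B ` cbox a b" if "x \<in> cbox (B *v a) (B *v b)" for x
      proof (rule image_eqI)
        show "x = B *v (B *v x)"
          by (simp add: B vec_eq_iff)
        have "a $ i \<le> x $ ?\<tau> i \<and> x $ ?\<tau> i \<le> b $ i" for i
          using that unfolding mem_box_cart B by (metis transpose_involutory vec_lambda_beta)
        then show "B *v x \<in> cbox a b"
          by (simp add: B mem_box_cart)
      qed
      then show ?thesis
        by (auto simp: B mem_box_cart)
    qed
    have "measure lebesgue ((*v) B ` cbox a b) = 1 * measure lebesgue (cbox a b)" for a b
    proof (cases "cbox a b = {}")
      case False
      then have "cbox (B *v a) (B *v b) \<noteq> {}"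
        using box[of a b] by force
      moreover have "(\<Prod>i\<in>UNIV. b $ ?\<tau> i - a $ ?\<tau> i) = (\<Prod>i\<in>UNIV. b $ i - a $ i)"
        by (rule prod.reindex_bij_betw) simp
      ultimately show ?thesis
        unfolding box using False by (simp add: content_cbox_cart B)
    qed simp
    then have scale: "(*v) B ` S \<in> lmeasurable \<and> 1 * measure lebesgue S = measure lebesgue ((*v) B ` S)"
      if "S \<in> lmeasurable" for S
      using measure_linear_sufficient[of "(*v) B" S 1] matrix_vector_mul_linear[of B] that by blast
    have "?Q B"
    proof
      fix S :: "(real^'n) set" assume "S \<in> lmeasurable"
      from scale[OF this] show "(*v) B ` S \<in> lmeasurable \<and> measure lebesgue ((*v) B ` S) = \<bar>det B\<bar> * measure lebesgue S"
        by (simp add: det)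
    qed
    then show "det (\<chi> i j. mat 1 $ i $ ?\<tau> j :: real^'n^'n) \<noteq> 0 \<longrightarrow> ?Q (\<chi> i j. mat 1 $ i $ ?\<tau> j)"
      unfolding B_def[symmetric] by (rule impI)
  next
    fix m n :: 'n
    assume "m \<noteq> n"
    define B :: "real^'n^'n" where "B = (\<chi> i j. of_bool (i = m \<and> j = n \<or> i = j))"
    have "B *v x = (\<chi> i. if i = m then x $ m + x $ n else x $ i)" for x
    proof -
      have "(\<Sum>j\<in>UNIV. of_bool (i = m \<and> j = n \<or> i = j) * x $ j) =
          (\<Sum>j\<in>(if i = m then {m, n} else {i}). x $ j)" for i
        by (rule sum.mono_neutral_cong_right) (auto split: if_splits)
      then show ?thesis
        using \<open>m \<noteq> n\<close> by (auto simp: matrix_vector_mult_def vec_eq_iff B_def)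
    qed
    then have shear: "(*v) B = (\<lambda>x. \<chi> i. if i = m then x $ m + x $ n else x $ i)"
      by (intro ext)
    have "B = (\<chi> k. if k = m then row m (mat 1) + 1 *s row n (mat 1) else row k (mat 1))"
      using \<open>m \<noteq> n\<close> by (auto simp: vec_eq_iff row_def mat_def B_def)
    then have det: "det B = 1"
      using det_row_operation[OF \<open>m \<noteq> n\<close>, of "mat 1" "1::real"] by simp
    have "measure lebesgue ((*v) B ` cbox a b) = 1 * measure lebesgue (cbox a b)" for a b
    proof (cases "cbox a b = {}")
      case False
      \<comment> \<open>The volume of a sheared box is computed for nonnegative \<open>n\<close>-th coordinates: move a corner to the origin.\<close>
      have "a + (b - a) = b"
        by simp
      then have *: "cbox a b = (+) a ` cbox 0 (b - a)"
        using cbox_translation[of a 0 "b - a"] by (simp only: add_0_right)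
      then have ne: "cbox 0 (b - a) \<noteq> {}"
        using False by (metis image_empty)
      have "measure lebesgue ((*v) B ` cbox a b) = measure lebesgue ((+) (B *v a) ` (*v) B ` cbox 0 (b - a))"
        unfolding * image_image matrix_vector_right_distrib ..
      also have "\<dots> = measure lebesgue (cbox 0 (b - a))"
        unfolding measure_translation shear
        by (rule measure_shear_interval[OF \<open>m \<noteq> n\<close> ne]) simp
      also have "\<dots> = measure lebesgue (cbox a b)"
        unfolding * measure_translation ..
      finally show ?thesis by simp
    qed simp
    then have scale: "(*v) B ` S \<in> lmeasurable \<and> 1 * measure lebesgue S = measure lebesgue ((*v) B ` S)"
      if "S \<in> lmeasurable" for S
      using measure_linear_sufficient[of "(*v) B" S 1] matrix_vector_mul_linear[of B] that by blast
    have "?Q B"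
    proof
      fix S :: "(real^'n) set" assume "S \<in> lmeasurable"
      from scale[OF this] show "(*v) B ` S \<in> lmeasurable \<and> measure lebesgue ((*v) B ` S) = \<bar>det B\<bar> * measure lebesgue S"
        by (simp add: det)
    qed
    then show "det (\<chi> i j. of_bool (i = m \<and> j = n \<or> i = j) :: real^'n^'n) \<noteq> 0 \<longrightarrow>
        ?Q (\<chi> i j. of_bool (i = m \<and> j = n \<or> i = j))"
      unfolding B_def[symmetric] by (rule impI)
  qed
  then show ?thesis
    using assms by blast
qed

lemma matrix_inv_mult:
  fixes B :: "real^'n^'n"
  assumes "invertible B"
  shows "B ** matrix_inv B = mat 1" and "matrix_inv B ** B = mat 1"
  using assms unfolding invertible_def matrix_inv_def by (metis (mono_tags, lifting) someI_ex)+

lemma matrix_vector_mult_measurable [measurable]: "(*v) (B :: real^'n^'m) \<in> borel_measurable borel"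
  by (rule borel_measurable_continuous_onI) (rule matrix_vector_mult_linear_continuous_on)

text \<open>A locally finite Borel measure is determined by its values on boxes, so the formula for the
  measure of an image of a box already is the change of variables formula for integrals.\<close>

lemma lborel_matrix:
  fixes B :: "real^'n^'n"
  assumes "invertible B"
  shows "lborel = density (distr lborel borel ((*v) B)) (\<lambda>_. \<bar>det B\<bar>)"
proof (rule lborel_eqI)
  let ?C = "matrix_inv B"
  note BC = matrix_inv_mult(1)[OF assms] and CB = matrix_inv_mult(2)[OF assms]
  have det: "\<bar>det B\<bar> * \<bar>det ?C\<bar> = 1"
    using arg_cong[OF BC, of det] by (simp add: det_mul flip: abs_mult)
  fix l u :: "real^'n"
  assume le: "\<And>b. b \<in> Basis \<Longrightarrow> l \<bullet> b \<le> u \<bullet> b"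
  have pre: "(*v) B -` box l u = (*v) ?C ` box l u"
  proof (intro equalityI subsetI)
    fix x assume "x \<in> (*v) B -` box l u"
    then show "x \<in> (*v) ?C ` box l u"
      by (intro image_eqI[of _ _ "B *v x"]) (auto simp: matrix_vector_mul_assoc CB)
  qed (auto simp: matrix_vector_mul_assoc BC)
  have sets: "(*v) B -` box l u \<in> sets borel"
    using measurable_sets[of "(*v) B" borel borel "box l u"] by simp
  have m: "(*v) ?C ` box l u \<in> lmeasurable"
    "measure lebesgue ((*v) ?C ` box l u) = \<bar>det ?C\<bar> * measure lebesgue (box l u)"
    using measure_matrix_image[of ?C "box l u"] det by force+
  have "emeasure (density (distr lborel borel ((*v) B)) (\<lambda>_. \<bar>det B\<bar>)) (box l u) =
      ennreal \<bar>det B\<bar> * emeasure lborel ((*v) B -` box l u)"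
    by (simp add: emeasure_density nn_integral_cmult_indicator emeasure_distr)
  also have "emeasure lborel ((*v) B -` box l u) = emeasure lebesgue ((*v) ?C ` box l u)"
    using sets by (simp add: pre)
  also have "\<dots> = ennreal (\<bar>det ?C\<bar> * measure lebesgue (box l u))"
    using m by (simp add: emeasure_eq_measure2)
  also have "ennreal \<bar>det B\<bar> * \<dots> = ennreal (measure lebesgue (box l u))"
    using det by (simp add: flip: ennreal_mult mult.assoc)
  also have "\<dots> = (\<Prod>b\<in>Basis. (u - l) \<bullet> b)"
    using le by (simp add: measure_lborel_box)
  finally show "emeasure (density (distr lborel borel ((*v) B)) (\<lambda>_. \<bar>det B\<bar>)) (box l u) =
      (\<Prod>b\<in>Basis. (u - l) \<bullet> b)" .
qed simp


section \<open>Integrals over the Brillouin zone\<close>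

lemma brillouin_zone_eq_vimage:
  assumes "invertible A"
  shows "brillouin_zone A = (*v) (transpose A) -` {u. \<forall>i. 0 \<le> u $ i \<and> u $ i < 1}"
proof -
  let ?B = "matrix_inv (transpose A)"
  note matrix_inv_mult[OF transpose_invertible[OF assms]]
  then have inv: "transpose A *v (?B *v u) = u" "?B *v (transpose A *v u) = u" for u
    by (simp_all add: matrix_vector_mul_assoc del: transpose_matrix_vector)
  show ?thesis
  proof (intro equalityI subsetI)
    fix p assume "p \<in> (*v) (transpose A) -` {u. \<forall>i. 0 \<le> u $ i \<and> u $ i < 1}"
    then show "p \<in> brillouin_zone A"
      unfolding brillouin_zone_def by (intro image_eqI[of _ _ "transpose A *v p"]) (auto simp: inv simp del: transpose_matrix_vector)
  qed (auto simp: brillouin_zone_def inv simp del: transpose_matrix_vector)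
qed

lemma borel_unit_cube [measurable]: "{u :: real^'n. \<forall>i. 0 \<le> u $ i \<and> u $ i < 1} \<in> sets borel"
proof -
  have "{u :: real^'n. \<forall>i. 0 \<le> u $ i \<and> u $ i < 1} =
      (\<Inter>i. {u. 0 \<le> u $ i} \<inter> {u. u $ i < 1})"
    by auto
  also have "\<dots> \<in> sets borel"
    by (intro sets.countable_INT'' sets.Int borel_closed borel_open) (auto intro!: closed_Collect_le open_Collect_less continuous_intros)
  finally show ?thesis .
qed

lemma borel_brillouin_zone:
  assumes "invertible A"
  shows "brillouin_zone A \<in> sets borel"
  unfolding brillouin_zone_eq_vimage[OF assms]
  using measurable_sets[OF matrix_vector_mult_measurable borel_unit_cube] by (simp del: transpose_matrix_vector)

lemma bounded_brillouin_zone: "bounded (brillouin_zone A)"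
proof -
  have "{u :: real^'n. \<forall>i. 0 \<le> u $ i \<and> u $ i < 1} \<subseteq> cbox 0 (\<chi> i. 1)"
    by (auto simp: mem_box_cart less_imp_le)
  then have "bounded {u :: real^'n. \<forall>i. 0 \<le> u $ i \<and> u $ i < 1}"
    using bounded_cbox bounded_subset by blast
  then show ?thesis
    unfolding brillouin_zone_def by (intro bounded_linear_image) simp_all
qed

text \<open>The factor \<open>V\<^sub>\<Lambda>\<close> in the definition of the convolution is the reciprocal of the volume of the
  Brillouin zone: it makes the average over the Brillouin zone the integral over the unit cube.\<close>

lemma set_integral_brillouin_zone:
  fixes f :: "real^'n \<Rightarrow> complex"
  assumes A: "invertible A" and [measurable]: "f \<in> borel_measurable borel"
  shows "complex_of_real (cell_volume A) * (LINT p:brillouin_zone A|lborel. f p) =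
      (LINT u:{u. \<forall>i. 0 \<le> u $ i \<and> u $ i < 1}|lborel. f (matrix_inv (transpose A) *v u))"
proof -
  let ?B = "matrix_inv (transpose A)"
  let ?Q = "{u :: real^'n. \<forall>i. 0 \<le> u $ i \<and> u $ i < 1}"
  note BC = matrix_inv_mult[OF transpose_invertible[OF A]]
  then have B: "invertible ?B"
    unfolding invertible_def by blast
  have det: "\<bar>det A\<bar> * \<bar>det ?B\<bar> = 1"
    using arg_cong[OF BC(1), of det] by (simp add: det_mul flip: abs_mult)
  have ind: "indicat_real (brillouin_zone A) (?B *v u) = indicator ?Q u" for u
    unfolding brillouin_zone_eq_vimage[OF A] indicator_def by (simp add: matrix_vector_mul_assoc BC del: transpose_matrix_vector)
  note [measurable] = borel_brillouin_zone[OF A]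
  have "(LINT p:brillouin_zone A|lborel. f p) =
      (\<integral>p. indicator (brillouin_zone A) p *\<^sub>R f p \<partial>density (distr lborel borel ((*v) ?B)) (\<lambda>_. \<bar>det ?B\<bar>))"
    unfolding set_lebesgue_integral_def by (subst lborel_matrix[OF B]) (rule refl)
  also have "\<dots> = (\<integral>u. \<bar>det ?B\<bar> *\<^sub>R (indicator (brillouin_zone A) (?B *v u) *\<^sub>R f (?B *v u)) \<partial>lborel)"
    by (subst integral_density) (simp_all add: integral_distr)
  also have "\<dots> = \<bar>det ?B\<bar> *\<^sub>R (LINT u:?Q|lborel. f (?B *v u))"
    by (simp add: set_lebesgue_integral_def ind del: scaleR_scaleR)
  finally have "complex_of_real (cell_volume A) * (LINT p:brillouin_zone A|lborel. f p) =
      complex_of_real (\<bar>det A\<bar> * \<bar>det ?B\<bar>) * (LINT u:?Q|lborel. f (?B *v u))"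
    by (simp add: cell_volume_def scaleR_conv_of_real)
  then show ?thesis
    unfolding det by simp
qed

definition phase :: "real^'n \<Rightarrow> real^'n \<Rightarrow> complex" where
  "phase y k = exp (- 2 * complex_of_real pi * \<i> * complex_of_real (y \<bullet> k))"

lemma norm_phase [simp]: "norm (phase y k) = 1"
  by (simp add: phase_def)

lemma phase_add: "phase (y + z) k = phase y k * phase z k"
  by (simp add: phase_def inner_add_left ring_distribs flip: exp_add)

text \<open>The integrand of a convolution of two characters is again a character in the integration
  variable, and the two frequencies enter through their difference only.\<close>

lemma phase_diff_right: "phase y (k - p) * phase z p = phase y k * phase (z - y) p"
  by (simp add: phase_def inner_diff_left inner_diff_right algebra_simps flip: exp_add)

lemma continuous_on_phase [continuous_intros]: "continuous_on S (phase y)"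
  unfolding phase_def by (intro continuous_intros)

lemma integral_unit_interval_exp:
  assumes "m \<in> \<int>"
  shows "(\<integral>t. indicator {0..<1::real} t *\<^sub>R
      exp (- 2 * complex_of_real pi * \<i> * complex_of_real (m * t)) \<partial>lborel) = of_bool (m = 0)"
proof -
  let ?c = "- 2 * complex_of_real pi * \<i> * complex_of_real m"
  let ?e = "\<lambda>t. exp (?c * complex_of_real t)"
  have "(\<integral>t. indicator {0..<1::real} t *\<^sub>R
      exp (- 2 * complex_of_real pi * \<i> * complex_of_real (m * t)) \<partial>lborel) =
      (\<integral>t. indicator {0..1::real} t *\<^sub>R ?e t \<partial>lborel)"
  proof (rule integral_cong_AE)
    show "AE t in lborel. indicator {0..<1::real} t *\<^sub>R
      exp (- 2 * complex_of_real pi * \<i> * complex_of_real (m * t)) = indicator {0..1} t *\<^sub>R ?e t"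
      using AE_lborel_singleton[of 1] by eventually_elim (auto simp: indicator_def mult_ac)
  qed measurable
  also have "\<dots> = of_bool (m = 0)"
  proof (cases "m = 0")
    case True
    then show ?thesis by simp
  next
    case False
    have "(\<integral>t. indicator {0..1::real} t *\<^sub>R ?e t \<partial>lborel) = ?e 1 / ?c - ?e 0 / ?c"
    proof (rule integral_FTC_atLeastAtMost)
      show "((\<lambda>t. ?e t / ?c) has_vector_derivative ?e t) (at t within {0..1})" for t
        using False by (auto intro!: derivative_eq_intros has_vector_derivative_real_field simp: field_simps)
    qed (auto intro!: continuous_intros)
    also have "?e 1 = 1"
      using assms by (auto elim!: Ints_cases simp: exp_minus exp_eq_1)
    finally show ?thesis
      using False by simp
  qed
  finally show ?thesis .
qed

lemma integral_lborel_prod: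
  fixes f :: "'a::euclidean_space \<Rightarrow> real \<Rightarrow> complex"
  assumes "\<And>b. b \<in> Basis \<Longrightarrow> integrable lborel (f b)"
  shows "(\<integral>x. (\<Prod>b\<in>Basis. f b (x \<bullet> b)) \<partial>lborel) = (\<Prod>b\<in>Basis. \<integral>t. f b t \<partial>lborel)"
proof -
  interpret product_sigma_finite "\<lambda>_. lborel :: real measure"
    by unfold_locales
  have [measurable]: "f b \<in> borel_measurable borel" if "b \<in> Basis" for b
    using assms[OF that] by auto
  have "(\<integral>x. (\<Prod>b\<in>Basis. f b (x \<bullet> b)) \<partial>lborel) =
      (\<integral>x. (\<Prod>b\<in>Basis. f b (x \<bullet> b)) \<partial>distr (\<Pi>\<^sub>M b\<in>Basis. lborel) borel (\<lambda>g. \<Sum>b\<in>Basis. g b *\<^sub>R b))"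
    by (subst lborel_eq) (rule refl)
  also have "\<dots> = (\<integral>g. (\<Prod>b\<in>Basis. f b (g b)) \<partial>(\<Pi>\<^sub>M b\<in>Basis. lborel))"
    by (subst integral_distr) simp_all
  finally show ?thesis
    by (simp add: product_integral_prod assms)
qed

lemma integral_unit_cube_phase:
  fixes w :: "real^'n"
  assumes w: "\<And>i. w $ i \<in> \<int>"
  shows "(LINT u:{u. \<forall>i. 0 \<le> u $ i \<and> u $ i < 1}|lborel. phase w u) = of_bool (w = 0)"
proof -
  let ?h = "\<lambda>b t. indicator {0..<1::real} t *\<^sub>R
      exp (- 2 * complex_of_real pi * \<i> * complex_of_real ((w \<bullet> b) * t))"
  have split: "indicator {u. \<forall>i. 0 \<le> u $ i \<and> u $ i < 1} u *\<^sub>R phase w u = (\<Prod>b\<in>Basis. ?h b (u \<bullet> b))" for u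
  proof -
    have "(\<Prod>b\<in>Basis. indicat_real {0..<1} (u \<bullet> b)) = of_bool (\<forall>b\<in>Basis. u \<bullet> b \<in> {0..<1})"
      by (auto simp: indicator_def of_bool_def prod_zero_iff)
    also have "(\<forall>b\<in>Basis. u \<bullet> b \<in> {0..<1}) \<longleftrightarrow> (\<forall>i. 0 \<le> u $ i \<and> u $ i < 1)"
      by (auto simp: Basis_vec_def inner_axis)
    finally have ind: "(\<Prod>b\<in>Basis. indicat_real {0..<1} (u \<bullet> b)) = indicator {u. \<forall>i. 0 \<le> u $ i \<and> u $ i < 1} u"
      by (simp add: indicator_def)
    have ph: "(\<Prod>b\<in>Basis. exp (- 2 * complex_of_real pi * \<i> * complex_of_real ((w \<bullet> b) * (u \<bullet> b)))) = phase w u"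
      unfolding phase_def by (subst euclidean_inner) (simp add: sum_distrib_left flip: exp_sum)
    show ?thesis
      unfolding prod.distrib scaleR_conv_of_real ph ind[symmetric] of_real_prod by simp
  qed
  have "integrable lborel (?h b)" for b
    by (rule integrableI_bounded_set_indicator[where B = 1]) auto
  then have "(LINT u:{u. \<forall>i. 0 \<le> u $ i \<and> u $ i < 1}|lborel. phase w u) = (\<Prod>b\<in>Basis. \<integral>t. ?h b t \<partial>lborel)"
    unfolding set_lebesgue_integral_def split by (intro integral_lborel_prod)
  also have "\<dots> = (\<Prod>b\<in>Basis. of_bool (w \<bullet> b = 0))"
    by (intro prod.cong refl integral_unit_interval_exp) (auto simp: Basis_vec_def inner_axis w)
  also have "\<dots> = of_bool (\<forall>b\<in>Basis. w \<bullet> b = 0)"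
    by (auto simp: of_bool_def prod_zero_iff)
  also have "\<dots> = of_bool (w = 0)"
    using euclidean_all_zero_iff[of w] by simp
  finally show ?thesis .
qed

text \<open>Orthogonality of characters. In the coordinates of the unit cube the lattice vector
  \<open>A w\<close> becomes the integer vector \<open>w\<close>, and the integral factorises into integrals of
  \<open>exp (- 2 \<pi> i w\<^sub>j t)\<close> over the unit interval, one of which vanishes unless \<open>w = 0\<close>.\<close>

lemma integral_brillouin_zone_phase:
  assumes A: "invertible A" and y: "y \<in> bravais_lattice A"
  shows "complex_of_real (cell_volume A) * (LINT p:brillouin_zone A|lborel. phase y p) = of_bool (y = 0)"
proof -
  let ?B = "matrix_inv (transpose A)"
  obtain w where w: "y = A *v w" "\<forall>i. w $ i \<in> \<int>"
    using y by (auto simp: bravais_lattice_def)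
  note AB = matrix_inv_mult(1)[OF transpose_invertible[OF A]]
  have "y \<bullet> (?B *v u) = w \<bullet> u" for u
  proof -
    have "y \<bullet> (?B *v u) = w \<bullet> (transpose A *v (?B *v u))"
      by (simp add: w(1) dot_lmul_matrix[of "?B *v u" A w] inner_commute[of w] inner_commute[of _ "?B *v u"])
    then show ?thesis
      by (simp add: matrix_vector_mul_assoc AB del: transpose_matrix_vector)
  qed
  then have "phase y (?B *v u) = phase w u" for u
    by (simp add: phase_def)
  then have "complex_of_real (cell_volume A) * (LINT p:brillouin_zone A|lborel. phase y p) = of_bool (w = 0)"
    using set_integral_brillouin_zone[OF A, of "phase y"] integral_unit_cube_phase[of w] w(2)
    by (simp add: borel_measurable_continuous_onI continuous_on_phase)
  moreover have "y = 0 \<longleftrightarrow> w = 0"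
    using A w(1) by (metis invertible_eq_bij bij_def injD matrix_vector_mult_0_right)
  ultimately show ?thesis by simp
qed


section \<open>Trigonometric series under multiplication and convolution\<close>

text \<open>A dominated series of continuous functions converges uniformly along the net of finite
  subsets of the index set, and integration over a set of finite measure is continuous with respect
  to uniform convergence.\<close>

lemma set_integral_infsum:
  fixes f :: "'i \<Rightarrow> 'a::euclidean_space \<Rightarrow> complex"
  assumes X: "X \<in> sets borel" "bounded X"
    and cont: "\<And>i. i \<in> I \<Longrightarrow> continuous_on UNIV (f i)"
    and bound: "\<And>i p. i \<in> I \<Longrightarrow> norm (f i p) \<le> M i"
    and M: "M summable_on I"
  shows "(LINT p:X|lborel. \<Sum>\<^sub>\<infinity>i\<in>I. f i p) = (\<Sum>\<^sub>\<infinity>i\<in>I. LINT p:X|lborel. f i p)"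
proof -
  let ?S = "\<lambda>p. \<Sum>\<^sub>\<infinity>i\<in>I. f i p"
  have ul: "uniform_limit UNIV (\<lambda>F p. \<Sum>i\<in>F. f i p) ?S (finite_subsets_at_top I)"
    by (rule Weierstrass_m_test_general[OF bound M])
  have fin: "\<forall>\<^sub>F F in finite_subsets_at_top I. finite F \<and> F \<subseteq> I"
    by (simp add: eventually_finite_subsets_at_top_weakI)
  have fmX: "emeasure lborel X < \<infinity>"
    using emeasure_bounded_finite[OF X(2)] by simp
  have contS: "continuous_on UNIV ?S"
  proof (rule uniform_limit_theorem[OF _ ul])
    show "\<forall>\<^sub>F F in finite_subsets_at_top I. continuous_on UNIV (\<lambda>p. \<Sum>i\<in>F. f i p)"
      using fin by eventually_elim (auto intro!: continuous_on_sum cont)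
  qed simp
  have int: "set_integrable lborel X g" if "continuous_on UNIV g" for g :: "'a \<Rightarrow> complex"
  proof -
    have "compact (closure X)"
      using X(2) by simp
    then have "set_integrable lborel (closure X) g"
      unfolding set_integrable_def
      by (intro borel_integrable_compact continuous_on_subset[OF that]) simp_all
    then show ?thesis
      by (rule set_integrable_subset) (use X(1) closure_subset in auto)
  qed
  have "((\<lambda>i. LINT p:X|lborel. f i p) has_sum (LINT p:X|lborel. ?S p)) I"
    unfolding has_sum_def
  proof (rule tendstoI)
    fix e :: real
    assume "e > 0"
    let ?m = "measure lborel X"
    \<comment> \<open>The summand 1 covers the case that \<open>X\<close> is a null set.\<close>
    let ?d = "e / (?m + 1)"
    have d: "?d > 0"
      using \<open>e > 0\<close> by (simp add: add_nonneg_pos)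
    have "\<forall>\<^sub>F F in finite_subsets_at_top I. \<forall>p\<in>UNIV. dist (\<Sum>i\<in>F. f i p) (?S p) < ?d"
      using ul d by (rule uniform_limitD)
    then show "\<forall>\<^sub>F F in finite_subsets_at_top I.
        dist (\<Sum>i\<in>F. LINT p:X|lborel. f i p) (LINT p:X|lborel. ?S p) < e"
      using fin
    proof eventually_elim
      fix F
      assume F: "\<forall>p\<in>UNIV. dist (\<Sum>i\<in>F. f i p) (?S p) < ?d" "finite F \<and> F \<subseteq> I"
      let ?g = "\<lambda>p. (\<Sum>i\<in>F. f i p) - ?S p"
      have "continuous_on UNIV ?g"
        using F by (intro continuous_intros contS) (auto intro: cont)
      have sum: "(\<Sum>i\<in>F. LINT p:X|lborel. f i p) = (LINT p:X|lborel. \<Sum>i\<in>F. f i p)"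
        using F int[OF cont]
        unfolding set_lebesgue_integral_def set_integrable_def scaleR_sum_right
        by (subst Bochner_Integration.integral_sum) auto
      have "dist (\<Sum>i\<in>F. LINT p:X|lborel. f i p) (LINT p:X|lborel. ?S p) = norm (LINT p:X|lborel. ?g p)"
        unfolding dist_norm sum using F
        by (subst set_integral_diff) (auto intro!: int contS continuous_on_sum cont)
      also have "\<dots> \<le> (\<integral>p. indicator X p *\<^sub>R ?d \<partial>lborel)"
        unfolding set_lebesgue_integral_def
      proof (rule Bochner_Integration.integral_norm_bound_integral)
        show "integrable lborel (\<lambda>p. indicator X p *\<^sub>R ?g p)"
          using int[OF \<open>continuous_on UNIV ?g\<close>] by (simp add: set_integrable_def)
        show "integrable lborel (\<lambda>p. indicator X p *\<^sub>R ?d)"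
          using X(1) fmX by (intro integrable_scaleR_left) (simp add: integrable_indicator_iff)
        show "norm (indicator X p *\<^sub>R ?g p) \<le> indicator X p *\<^sub>R ?d" for p
          using F(1) less_imp_le by (fastforce simp: dist_norm indicator_def)
      qed
      also have "\<dots> = ?m * ?d"
        using X(1) by simp
      also have "\<dots> < (?m + 1) * ?d"
        using d by (intro mult_strict_right_mono) simp_all
      also have "\<dots> = e"
        by (simp add: add_nonneg_pos[THEN less_imp_neq, symmetric])
      finally show "dist (\<Sum>i\<in>F. LINT p:X|lborel. f i p) (LINT p:X|lborel. ?S p) < e" .
    qed
  qed
  then show ?thesis
    by (rule infsumI[symmetric])
qed

lemma abs_summable_on_Times_mult:
  fixes f :: "'a \<Rightarrow> complex" and g :: "'b \<Rightarrow> complex"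
  assumes f: "(\<lambda>i. norm (f i)) summable_on I" and g: "(\<lambda>j. norm (g j)) summable_on J"
  shows "(\<lambda>(i, j). norm (f i * g j)) summable_on I \<times> J"
proof -
  have inner: "(\<lambda>j. norm (f i * g j)) summable_on J" for i
    unfolding norm_mult by (rule summable_on_cmult_right) (rule g)
  have "norm (\<Sum>\<^sub>\<infinity>j\<in>J. norm (f i * g j)) = norm (f i) * (\<Sum>\<^sub>\<infinity>j\<in>J. norm (g j))" for i
    unfolding norm_mult infsum_cmult_right' by (simp add: infsum_nonneg)
  then have outer: "(\<lambda>i. norm (\<Sum>\<^sub>\<infinity>j\<in>J. norm (f i * g j))) summable_on I"
    by (simp only:) (rule summable_on_cmult_left, rule f)
  have "(\<lambda>q. norm ((\<lambda>(i, j). f i * g j) q)) summable_on I \<times> J"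
    using inner outer by (subst Infinite_Sum.abs_summable_on_Sigma_iff) simp
  then show ?thesis
    by (simp add: case_prod_unfold)
qed

lemma infsum_Times_mult:
  fixes f :: "'a \<Rightarrow> complex" and g :: "'b \<Rightarrow> complex"
  assumes f: "(\<lambda>i. norm (f i)) summable_on I" and g: "(\<lambda>j. norm (g j)) summable_on J"
  shows "(\<Sum>\<^sub>\<infinity>i\<in>I. f i) * (\<Sum>\<^sub>\<infinity>j\<in>J. g j) = (\<Sum>\<^sub>\<infinity>(i, j)\<in>I \<times> J. f i * g j)"
proof -
  have "(\<lambda>q. norm ((\<lambda>(i, j). f i * g j) q)) summable_on I \<times> J"
    using abs_summable_on_Times_mult[OF f g] by (simp add: case_prod_unfold)
  then have "(\<lambda>(i, j). f i * g j) summable_on I \<times> J"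
    by (rule Infinite_Sum.abs_summable_summable)
  then have "(\<Sum>\<^sub>\<infinity>i\<in>I. \<Sum>\<^sub>\<infinity>j\<in>J. f i * g j) = (\<Sum>\<^sub>\<infinity>(i, j)\<in>I \<times> J. f i * g j)"
    by (rule infsum_Sigma'_banach)
  then show ?thesis
    by (simp only: infsum_cmult_right' infsum_cmult_left')
qed

text \<open>A trigonometric series with arbitrary index set, frequencies \<open>y\<close> and coefficients \<open>c\<close>;
  different indices may have the same frequency. A graph lattice sum has this form with the
  placements of the nodes as indices, the position of the sink as frequency, and the product of the
  kernels as coefficient.\<close>

definition fourier_sum :: "'i set \<Rightarrow> ('i \<Rightarrow> complex) \<Rightarrow> ('i \<Rightarrow> real^'n) \<Rightarrow> real^'n \<Rightarrow> complex" where
  "fourier_sum I c y k = (\<Sum>\<^sub>\<infinity>i\<in>I. phase (y i) k * c i)"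

lemma abs_summable_phase:
  assumes "(\<lambda>i. norm (c i)) summable_on I"
  shows "(\<lambda>i. norm (phase (y i) k * c i)) summable_on I"
  using assms by (simp add: norm_mult)

lemma fourier_sum_mult:
  assumes c: "(\<lambda>i. norm (c i)) summable_on I" and d: "(\<lambda>j. norm (d j)) summable_on J"
  shows "fourier_sum I c y k * fourier_sum J d z k =
    fourier_sum (I \<times> J) (\<lambda>(i, j). c i * d j) (\<lambda>(i, j). y i + z j) k"
  unfolding fourier_sum_def infsum_Times_mult[OF abs_summable_phase[OF c] abs_summable_phase[OF d]]
  by (intro infsum_cong) (auto simp: phase_add)

text \<open>Expanding both factors, the integration over the Brillouin zone retains exactly those pairs of
  indices that have equal frequencies. This is why a convolution glues two graphs along both
  terminals: it forces the two sinks into the same position.\<close>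

lemma fourier_sum_convolution:
  fixes c :: "'i \<Rightarrow> complex" and d :: "'j \<Rightarrow> complex"
  assumes A: "invertible A"
    and c: "(\<lambda>i. norm (c i)) summable_on I" and d: "(\<lambda>j. norm (d j)) summable_on J"
    and y: "\<And>i. i \<in> I \<Longrightarrow> y i \<in> bravais_lattice A" and z: "\<And>j. j \<in> J \<Longrightarrow> z j \<in> bravais_lattice A"
  shows "convolution A (fourier_sum I c y) (fourier_sum J d z) k =
    fourier_sum {(i, j) \<in> I \<times> J. y i = z j} (\<lambda>(i, j). c i * d j) (\<lambda>(i, j). y i) k"
proof -
  let ?a = "\<lambda>(i, j). phase (y i) k * (c i * d j)" and ?w = "\<lambda>(i, j). z j - y i"
  have abs: "(\<lambda>q. norm (?a q)) summable_on I \<times> J"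
    using abs_summable_on_Times_mult[OF c d] by (simp add: norm_mult case_prod_unfold)
  have prod: "fourier_sum I c y (k - p) * fourier_sum J d z p =
      (\<Sum>\<^sub>\<infinity>q\<in>I \<times> J. phase (?w q) p * ?a q)" for p
  proof -
    have "fourier_sum I c y (k - p) * fourier_sum J d z p =
        (\<Sum>\<^sub>\<infinity>(i, j)\<in>I \<times> J. (phase (y i) (k - p) * c i) * (phase (z j) p * d j))"
      unfolding fourier_sum_def by (intro infsum_Times_mult abs_summable_phase c d)
    also have "\<dots> = (\<Sum>\<^sub>\<infinity>q\<in>I \<times> J. phase (?w q) p * ?a q)"
    proof (rule infsum_cong)
      fix q :: "'i \<times> 'j"
      obtain i j where q: "q = (i, j)"
        by (cases q)
      have "(phase (y i) (k - p) * c i) * (phase (z j) p * d j) =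
          (phase (y i) (k - p) * phase (z j) p) * (c i * d j)"
        by (simp add: mult_ac)
      then show "(case q of (i, j) \<Rightarrow> (phase (y i) (k - p) * c i) * (phase (z j) p * d j)) = phase (?w q) p * ?a q"
        unfolding phase_diff_right q by (simp add: mult_ac)
    qed
    finally show ?thesis .
  qed
  have "convolution A (fourier_sum I c y) (fourier_sum J d z) k =
      complex_of_real (cell_volume A) * (LINT p:brillouin_zone A|lborel. \<Sum>\<^sub>\<infinity>q\<in>I \<times> J. phase (?w q) p * ?a q)"
    unfolding convolution_def prod ..
  also have "\<dots> = complex_of_real (cell_volume A) *
      (\<Sum>\<^sub>\<infinity>q\<in>I \<times> J. LINT p:brillouin_zone A|lborel. phase (?w q) p * ?a q)"
  proof (rule arg_cong[OF set_integral_infsum])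
    show "continuous_on UNIV (\<lambda>p. phase (?w q) p * ?a q)" for q
      by (intro continuous_intros)
    show "norm (phase (?w q) p * ?a q) \<le> norm (?a q)" for q p
      by (simp add: norm_mult)
  qed (rule borel_brillouin_zone[OF A] bounded_brillouin_zone abs)+
  \<comment> \<open>Orthogonality of characters selects the pairs with equal frequencies.\<close>
  also have "\<dots> = (\<Sum>\<^sub>\<infinity>q\<in>I \<times> J. of_bool (?w q = 0) * ?a q)"
  proof (subst infsum_cmult_right'[symmetric], rule infsum_cong)
    fix q assume "q \<in> I \<times> J"
    then have "?w q \<in> bravais_lattice A"
      using y z by (auto intro: bravais_lattice_diff)
    then show "complex_of_real (cell_volume A) * (LINT p:brillouin_zone A|lborel. phase (?w q) p * ?a q) =
        of_bool (?w q = 0) * ?a q"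
      using integral_brillouin_zone_phase[OF A, of "?w q"] by (simp flip: mult.assoc)
  qed
  also have "\<dots> = (\<Sum>\<^sub>\<infinity>q\<in>{(i, j) \<in> I \<times> J. y i = z j}. ?a q)"
    by (rule infsum_cong_neutral) auto
  finally show ?thesis
    unfolding fourier_sum_def by (simp add: case_prod_unfold)
qed


section \<open>Placements of the nodes\<close>

text \<open>The bridges, the whole network, and everything between them in a series-parallel decomposition
  have this form.\<close>

definition subnetwork :: "('v, 'e, 'n::finite) network \<Rightarrow> 'v set \<Rightarrow> 'e set \<Rightarrow> 'v \<Rightarrow> 'v \<Rightarrow> ('v, 'e, 'n) network" where
  "subnetwork G V E s t =
     \<lparr> multigraph = \<lparr> verts = V, arcs = E, tail = tail (multigraph G), head = head (multigraph G) \<rparr>,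
       kernel = kernel G, source = s, sink = t \<rparr>"

definition placements :: "real^'n^'n \<Rightarrow> 'v set \<Rightarrow> 'v \<Rightarrow> ('v \<Rightarrow> real^'n) set" where
  "placements A V p = (\<Pi>\<^sub>E v\<in>V. if v = p then {0} else bravais_lattice A)"

definition weight :: "('v, 'e, 'n::finite) network \<Rightarrow> 'e set \<Rightarrow> ('v \<Rightarrow> real^'n) \<Rightarrow> complex" where
  "weight G E x = (\<Prod>e\<in>E. kernel G e (x (head (multigraph G) e) - x (tail (multigraph G) e)))"

lemma mem_placements:
  "x \<in> placements A V p \<longleftrightarrow>
    x \<in> extensional V \<and> (\<forall>v\<in>V. x v \<in> bravais_lattice A) \<and> (p \<in> V \<longrightarrow> x p = 0)"
proof -
  have "x v \<in> (if v = p then {0} else bravais_lattice A) \<longleftrightarrow>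
      x v \<in> bravais_lattice A \<and> (v = p \<longrightarrow> x v = 0)" for v
    using bravais_lattice_0[of A] by (cases "v = p") (simp, metis, simp)
  then show ?thesis
    unfolding placements_def PiE_iff by blast
qed

text \<open>The source is pinned at the origin, so that the phase depends on the position of the sink only.\<close>

lemma graph_lattice_sum_subnetwork:
  assumes "s \<in> V"
  shows "graph_lattice_sum A (subnetwork G V E s t) =
    fourier_sum (placements A V s) (weight G E) (\<lambda>x. x t)"
proof
  fix k
  have "graph_lattice_sum A (subnetwork G V E s t) k =
      (\<Sum>\<^sub>\<infinity>x\<in>placements A V s. phase (x t - x s) k * weight G E x)"
    unfolding graph_lattice_sum_def pinned_lattice_sum_def subnetwork_def placements_def weight_def phase_def
    by (simp only: network.simps pre_digraph.simps)
  also have "\<dots> = fourier_sum (placements A V s) (weight G E) (\<lambda>x. x t) k"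
    unfolding fourier_sum_def using assms by (intro infsum_cong) (simp add: mem_placements)
  finally show "graph_lattice_sum A (subnetwork G V E s t) k =
      fourier_sum (placements A V s) (weight G E) (\<lambda>x. x t) k" .
qed

lemma bridge_eq_subnetwork:
  "bridge G e (s, t) = subnetwork G {tail (multigraph G) e, head (multigraph G) e} {e} s t"
  by (simp add: bridge_def subnetwork_def)



section \<open>Gluing two components\<close>

text \<open>Two components, the first pinned at \<open>s\<close> and the second pinned at \<open>u\<close>, a node that
  they share. Series composition is the case that they share nothing else; in parallel composition
  \<open>u = s\<close>, and the sink is shared as well.\<close>

locale gluing =
  fixes A :: "real^'n^'n" and G :: "('v, 'e, 'n) network"
    and V1 V2 :: "'v set" and E1 E2 :: "'e set" and s u :: 'v
  assumes fin: "finite E1" "finite E2" and disj: "E1 \<inter> E2 = {}"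
    and ends1: "\<And>e. e \<in> E1 \<Longrightarrow> {tail (multigraph G) e, head (multigraph G) e} \<subseteq> V1"
    and ends2: "\<And>e. e \<in> E2 \<Longrightarrow> {tail (multigraph G) e, head (multigraph G) e} \<subseteq> V2"
    and s: "s \<in> V1" and u: "u \<in> V1" "u \<in> V2"
begin

text \<open>A pair of placements fits together if the second one, translated so that \<open>u\<close> sits where the
  first one puts it, agrees with the first one on all shared nodes.\<close>

definition compatible :: "(('v \<Rightarrow> real^'n) \<times> ('v \<Rightarrow> real^'n)) set" where
  "compatible = {(x1, x2) \<in> placements A V1 s \<times> placements A V2 u. \<forall>v\<in>V1 \<inter> V2. x1 v = x1 u + x2 v}"

definition glue :: "('v \<Rightarrow> real^'n) \<Rightarrow> ('v \<Rightarrow> real^'n) \<Rightarrow> 'v \<Rightarrow> real^'n" where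
  "glue x1 x2 = (\<lambda>v\<in>V1 \<union> V2. if v \<in> V1 then x1 v else x1 u + x2 v)"

lemma glue_left: "v \<in> V1 \<Longrightarrow> glue x1 x2 v = x1 v"
  by (simp add: glue_def)

lemma glue_right: "(x1, x2) \<in> compatible \<Longrightarrow> v \<in> V2 \<Longrightarrow> glue x1 x2 v = x1 u + x2 v"
  by (auto simp: glue_def compatible_def)

text \<open>A placement of the union is the same as a compatible pair: restrict it to both components and
  translate the second restriction so that \<open>u\<close> sits at the origin.\<close>

lemma bij_betw_glue: "bij_betw (\<lambda>(x1, x2). glue x1 x2) compatible (placements A (V1 \<union> V2) s)"
proof (rule bij_betw_byWitness[where f' = "\<lambda>x. (restrict x V1, \<lambda>v\<in>V2. x v - x u)"])
  let ?f = "\<lambda>(x1, x2). glue x1 x2" and ?g = "\<lambda>x. (restrict x V1, \<lambda>v\<in>V2. x v - x u)"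
  have "?g (glue x1 x2) = (x1, x2)" if c: "(x1, x2) \<in> compatible" for x1 x2
  proof -
    have "x1 \<in> extensional V1" "x2 \<in> extensional V2"
      using c by (auto simp: compatible_def mem_placements)
    then show ?thesis
      using u by (auto simp: fun_eq_iff glue_left glue_right[OF c] extensional_def)
  qed
  then show "\<forall>a\<in>compatible. ?g (?f a) = a"
    by auto
  have "glue (restrict x V1) (\<lambda>v\<in>V2. x v - x u) = x" if "x \<in> placements A (V1 \<union> V2) s" for x
  proof
    fix v
    have "x v = undefined" if "v \<notin> V1 \<union> V2"
      using \<open>x \<in> placements A (V1 \<union> V2) s\<close> that by (simp add: mem_placements extensional_def)
    then show "glue (restrict x V1) (\<lambda>v\<in>V2. x v - x u) v = x v"
      using u by (auto simp: glue_def)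
  qed
  then show "\<forall>x\<in>placements A (V1 \<union> V2) s. ?f (?g x) = x"
    by simp
  have "glue x1 x2 \<in> placements A (V1 \<union> V2) s" if "(x1, x2) \<in> compatible" for x1 x2
  proof -
    have "x1 \<in> placements A V1 s" "x2 \<in> placements A V2 u"
      using that by (simp_all add: compatible_def)
    then show ?thesis
      using s u by (auto simp: mem_placements glue_def intro: bravais_lattice_add)
  qed
  then show "?f ` compatible \<subseteq> placements A (V1 \<union> V2) s"
    by auto
  have "?g x \<in> compatible" if "x \<in> placements A (V1 \<union> V2) s" for x
    using that s u by (simp add: compatible_def mem_placements bravais_lattice_diff)
  then show "?g ` placements A (V1 \<union> V2) s \<subseteq> compatible"
    by auto
qed

text \<open>Each edge belongs to one component, and kernels see differences of positions only, so the
  translation of the second component does not change its weight.\<close>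

lemma weight_glue:
  assumes c: "(x1, x2) \<in> compatible"
  shows "weight G (E1 \<union> E2) (glue x1 x2) = weight G E1 x1 * weight G E2 x2"
proof -
  have "weight G E1 (glue x1 x2) = weight G E1 x1"
    unfolding weight_def using ends1 by (intro prod.cong) (simp_all add: glue_left)
  moreover have "weight G E2 (glue x1 x2) = weight G E2 x2"
    unfolding weight_def using ends2 by (intro prod.cong) (simp_all add: glue_right[OF c])
  moreover have "weight G (E1 \<union> E2) x = weight G E1 x * weight G E2 x" for x
    unfolding weight_def using fin disj by (intro prod.union_disjoint)
  ultimately show ?thesis by simp
qed

text \<open>The compatible pairs are among all pairs, over which the product of two absolutely summable
  weights is absolutely summable.\<close>

lemma abs_summable_weight:
  assumes "(\<lambda>x. norm (weight G E1 x)) summable_on placements A V1 s"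
    and "(\<lambda>x. norm (weight G E2 x)) summable_on placements A V2 u"
  shows "(\<lambda>x. norm (weight G (E1 \<union> E2) x)) summable_on placements A (V1 \<union> V2) s"
proof -
  have "(\<lambda>(x1, x2). norm (weight G E1 x1 * weight G E2 x2)) summable_on compatible"
    by (rule summable_on_subset_banach[OF abs_summable_on_Times_mult[OF assms]])
       (auto simp: compatible_def)
  also have "?this \<longleftrightarrow> (\<lambda>q. norm (weight G (E1 \<union> E2) ((\<lambda>(x1, x2). glue x1 x2) q))) summable_on compatible"
    by (intro summable_on_cong) (auto simp: weight_glue)
  also have "\<dots> \<longleftrightarrow> ?thesis"
    by (rule summable_on_reindex_bij_betw[OF bij_betw_glue])
  finally show ?thesis .
qed

lemma graph_lattice_sum_glue:
  "graph_lattice_sum A (subnetwork G (V1 \<union> V2) (E1 \<union> E2) s t) =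
    fourier_sum compatible (\<lambda>(x1, x2). weight G E1 x1 * weight G E2 x2) (\<lambda>(x1, x2). glue x1 x2 t)"
proof
  fix k
  have "(\<Sum>\<^sub>\<infinity>q\<in>compatible. (\<lambda>x. phase (x t) k * weight G (E1 \<union> E2) x) ((\<lambda>(x1, x2). glue x1 x2) q)) =
      (\<Sum>\<^sub>\<infinity>x\<in>placements A (V1 \<union> V2) s. phase (x t) k * weight G (E1 \<union> E2) x)"
    by (rule infsum_reindex_bij_betw[OF bij_betw_glue])
  then have "graph_lattice_sum A (subnetwork G (V1 \<union> V2) (E1 \<union> E2) s t) k =
      (\<Sum>\<^sub>\<infinity>q\<in>compatible. (\<lambda>x. phase (x t) k * weight G (E1 \<union> E2) x) ((\<lambda>(x1, x2). glue x1 x2) q))"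
    using s by (simp add: graph_lattice_sum_subnetwork fourier_sum_def)
  also have "\<dots> = fourier_sum compatible (\<lambda>(x1, x2). weight G E1 x1 * weight G E2 x2) (\<lambda>(x1, x2). glue x1 x2 t) k"
    unfolding fourier_sum_def by (intro infsum_cong) (auto simp: weight_glue)
  finally show "graph_lattice_sum A (subnetwork G (V1 \<union> V2) (E1 \<union> E2) s t) k =
    fourier_sum compatible (\<lambda>(x1, x2). weight G E1 x1 * weight G E2 x2) (\<lambda>(x1, x2). glue x1 x2 t) k" .
qed

text \<open>Sharing only \<open>u\<close> is no constraint, so the sum runs over all pairs of placements. The position
  of the sink is the sum of the two displacements, so the phase factorises along with the weight.\<close>

lemma graph_lattice_sum_series:
  assumes w1: "(\<lambda>x. norm (weight G E1 x)) summable_on placements A V1 s"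
    and w2: "(\<lambda>x. norm (weight G E2 x)) summable_on placements A V2 u"
    and V: "V1 \<inter> V2 = {u}" and t: "t \<in> V2"
  shows "graph_lattice_sum A (subnetwork G (V1 \<union> V2) (E1 \<union> E2) s t) =
    (\<lambda>k. graph_lattice_sum A (subnetwork G V1 E1 s u) k * graph_lattice_sum A (subnetwork G V2 E2 u t) k)"
proof
  fix k
  have compat: "compatible = placements A V1 s \<times> placements A V2 u"
    using u by (auto simp: compatible_def V mem_placements)
  have "fourier_sum compatible (\<lambda>(x1, x2). weight G E1 x1 * weight G E2 x2) (\<lambda>(x1, x2). glue x1 x2 t) k =
      fourier_sum compatible (\<lambda>(x1, x2). weight G E1 x1 * weight G E2 x2) (\<lambda>(x1, x2). x1 u + x2 t) k"
    unfolding fourier_sum_def by (intro infsum_cong) (auto simp: glue_right t)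
  then show "graph_lattice_sum A (subnetwork G (V1 \<union> V2) (E1 \<union> E2) s t) k =
    graph_lattice_sum A (subnetwork G V1 E1 s u) k * graph_lattice_sum A (subnetwork G V2 E2 u t) k"
    unfolding graph_lattice_sum_glue
    by (simp add: graph_lattice_sum_subnetwork s u fourier_sum_mult[OF w1 w2] compat)
qed

text \<open>With both components pinned at \<open>s\<close>, compatibility says that they put the common sink at the
  same position, which is the constraint a convolution imposes.\<close>

lemma graph_lattice_sum_parallel:
  assumes A: "invertible A"
    and w1: "(\<lambda>x. norm (weight G E1 x)) summable_on placements A V1 s"
    and w2: "(\<lambda>x. norm (weight G E2 x)) summable_on placements A V2 s"
    and us: "u = s" and V: "V1 \<inter> V2 = {s, t}"
  shows "graph_lattice_sum A (subnetwork G (V1 \<union> V2) (E1 \<union> E2) s t) =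
    convolution A (graph_lattice_sum A (subnetwork G V1 E1 s t)) (graph_lattice_sum A (subnetwork G V2 E2 s t))"
proof
  fix k
  have t: "t \<in> V1" "t \<in> V2"
    using V by auto
  have compat: "compatible = {(x1, x2) \<in> placements A V1 s \<times> placements A V2 s. x1 t = x2 t}"
    using u s unfolding compatible_def unfolding us V by (auto simp: mem_placements)
  have "graph_lattice_sum A (subnetwork G (V1 \<union> V2) (E1 \<union> E2) s t) k =
      fourier_sum compatible (\<lambda>(x1, x2). weight G E1 x1 * weight G E2 x2) (\<lambda>(x1, x2). x1 t) k"
    using t by (simp add: graph_lattice_sum_glue glue_left)
  also have "\<dots> = convolution A (fourier_sum (placements A V1 s) (weight G E1) (\<lambda>x. x t))
      (fourier_sum (placements A V2 s) (weight G E2) (\<lambda>x. x t)) k"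
    unfolding compat by (rule fourier_sum_convolution[OF A w1 w2, symmetric]) (use t in \<open>auto simp: mem_placements\<close>)
  finally show "graph_lattice_sum A (subnetwork G (V1 \<union> V2) (E1 \<union> E2) s t) k =
    convolution A (graph_lattice_sum A (subnetwork G V1 E1 s t)) (graph_lattice_sum A (subnetwork G V2 E2 s t)) k"
    using s u us by (simp add: graph_lattice_sum_subnetwork)
qed

end


section \<open>Summability of the weights\<close>

lemma series_parallel_between_finite:
  assumes "series_parallel_between ends V E s t"
  shows "finite V \<and> finite E"
  using assms by induction auto

lemma series_parallel_between_ends:
  assumes "series_parallel_between ends V E s t" and "e \<in> E"
  shows "ends e \<subseteq> V"
  using assms by (induction arbitrary: e) auto

text \<open>With one endpoint pinned, a single edge is placed by choosing the other endpoint.\<close>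

lemma bij_betw_placements_edge:
  assumes "s \<noteq> t"
  shows "bij_betw (\<lambda>x. x t) (placements A {s, t} s) (bravais_lattice A)"
  by (rule bij_betw_byWitness[where f' = "\<lambda>y. \<lambda>v\<in>{s, t}. if v = s then 0 else y"])
     (use assms in \<open>auto simp: mem_placements bravais_lattice_0 fun_eq_iff extensional_def\<close>)

lemma bij_betw_uminus_bravais_lattice: "bij_betw uminus (bravais_lattice A) (bravais_lattice A)"
proof -
  have "- x \<in> bravais_lattice A" if "x \<in> bravais_lattice A" for x
    using bravais_lattice_diff[OF bravais_lattice_0 that] by simp
  then show ?thesis
    by (intro bij_betw_byWitness[where f' = uminus]) auto
qed

text \<open>If the edge points from the sink to the source, the weight is the reflected kernel; the lattice
  is invariant under reflection.\<close>

lemma abs_summable_weight_edge: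
  assumes st: "s \<noteq> t" "{tail (multigraph G) e, head (multigraph G) e} = {s, t}"
    and K: "(\<lambda>x. norm (kernel G e x)) summable_on bravais_lattice A"
  shows "(\<lambda>x. norm (weight G {e} x)) summable_on placements A {s, t} s"
proof -
  consider "tail (multigraph G) e = s" "head (multigraph G) e = t"
    | "tail (multigraph G) e = t" "head (multigraph G) e = s"
    using st by (auto simp: doubleton_eq_iff)
  then show ?thesis
  proof cases
    case 1
    have "(\<lambda>x. norm (kernel G e (x t))) summable_on placements A {s, t} s"
      by (rule summable_on_reindex_bij_betw[OF bij_betw_placements_edge[OF st(1)], THEN iffD2, OF K])
    also have "?this \<longleftrightarrow> ?thesis"
      by (intro summable_on_cong) (simp add: weight_def 1 mem_placements)
    finally show ?thesis .
  next
    case 2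
    have "(\<lambda>y. norm (kernel G e (- y))) summable_on bravais_lattice A"
      by (rule summable_on_reindex_bij_betw[OF bij_betw_uminus_bravais_lattice, THEN iffD2, OF K])
    then have "(\<lambda>x. norm (kernel G e (- x t))) summable_on placements A {s, t} s"
      by (rule summable_on_reindex_bij_betw[OF bij_betw_placements_edge[OF st(1)], THEN iffD2])
    also have "?this \<longleftrightarrow> ?thesis"
      by (intro summable_on_cong) (simp add: weight_def 2 mem_placements)
    finally show ?thesis .
  qed
qed

lemma gluing_series_parallel:
  fixes G :: "('v, 'e, 'n::finite) network" and A :: "real^'n^'n"
  defines "ends \<equiv> \<lambda>e. {tail (multigraph G) e, head (multigraph G) e}"
  assumes "series_parallel_between ends V1 E1 s t1" "series_parallel_between ends V2 E2 u t2"
    and "E1 \<inter> E2 = {}" "u \<in> V1"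
  shows "gluing G V1 V2 E1 E2 s u"
proof
  show "finite E1" "finite E2"
    using assms(2,3) by (simp_all add: series_parallel_between_finite)
  show "{tail (multigraph G) e, head (multigraph G) e} \<subseteq> V1" if "e \<in> E1" for e
    using series_parallel_between_ends[OF assms(2) that] by (simp add: ends_def)
  show "{tail (multigraph G) e, head (multigraph G) e} \<subseteq> V2" if "e \<in> E2" for e
    using series_parallel_between_ends[OF assms(3) that] by (simp add: ends_def)
  show "s \<in> V1" "u \<in> V2"
    using assms(2,3) by (simp_all add: series_parallel_between_terminals)
qed (fact assms)+

lemma abs_summable_weight_series_parallel:
  fixes A :: "real^'n^'n" and G :: "('v, 'e, 'n::finite) network"
  assumes K: "summable_kernels A G"
    and sp: "series_parallel_between (\<lambda>e. {tail (multigraph G) e, head (multigraph G) e}) V E s t"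
    and E: "E \<subseteq> arcs (multigraph G)"
  shows "(\<lambda>x. norm (weight G E x)) summable_on placements A V s"
  using sp E
proof induction
  case (single_edge s t e)
  then show ?case
    using K by (intro abs_summable_weight_edge) (auto simp: summable_kernels_def)
next
  case (series_comp V1 E1 s u V2 E2 t)
  then interpret gluing A G V1 V2 E1 E2 s u
    by (intro gluing_series_parallel) auto
  show ?case
    using series_comp by (intro abs_summable_weight) auto
next
  case (parallel_comp V1 E1 s t V2 E2)
  then interpret gluing A G V1 V2 E1 E2 s s
    by (intro gluing_series_parallel) auto
  show ?case
    using parallel_comp by (intro abs_summable_weight) auto
qed


section \<open>Counting the operations\<close>

lemma generates_add:
  assumes "generates A M m c N"
  shows "generates A (M + R) m c (N + R)"
  using assms
proof induction
  case start
  show ?case by (rule generates.start)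
next
  case (multiply m c N f g)
  then show ?case
    using generates.multiply[of A "M + R" m c "N + R" f g] by (simp add: ac_simps)
next
  case (convolve m c N f g)
  then show ?case
    using generates.convolve[of A "M + R" m c "N + R" f g] by (simp add: ac_simps)
qed

lemma generates_trans:
  assumes "generates A N m' c' P" and "generates A M m c N"
  shows "generates A M (m + m') (c + c') P"
  using assms(1)
proof induction
  case start
  then show ?case using assms(2) by simp
next
  case (multiply m' c' N' f g)
  then show ?case
    using generates.multiply[of A M "m + m'" "c + c'" N' f g] by simp
next
  case (convolve m' c' N' f g)
  then show ?case
    using generates.convolve[of A M "m + m'" "c + c'" N' f g] by simp
qed

text \<open>Operations on one part of a collection leave the rest alone, so two collections can be
  processed one after the other, and the numbers of operations add up.\<close>

lemma generates_union:
  assumes "generates A M1 m1 c1 {#f#}" "generates A M2 m2 c2 {#g#}"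
  shows "generates A (M1 + M2) (m1 + m2) (c1 + c2) {#f, g#}"
proof -
  have "generates A (M1 + M2) m1 c1 ({#f#} + M2)"
    by (rule generates_add[OF assms(1)])
  moreover have "generates A ({#f#} + M2) m2 c2 {#f, g#}"
    using generates_add[OF assms(2), of "{#f#}"] by (simp add: add_mset_commute)
  ultimately show ?thesis
    by (rule generates_trans[rotated])
qed

text \<open>Each composition contributes one operation, a product for a series and a convolution for a
  parallel composition. In terms of node numbers, a series composition identifies one node, so that
  \<open>|V| - 2 = (|V\<^sub>1| - 2) + (|V\<^sub>2| - 2) + 1\<close>, while a parallel composition identifies two, so that
  \<open>|V| - 2 = (|V\<^sub>1| - 2) + (|V\<^sub>2| - 2)\<close>; edge numbers always add. Hence \<open>|V| - 2\<close> counts the products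
  and \<open>|E| - |V| + 1\<close> counts the convolutions.\<close>

lemma generates_series_parallel:
  fixes A :: "real^'n^'n" and G :: "('v, 'e, 'n::finite) network"
  defines "D \<equiv> multigraph G"
  assumes A: "invertible A" and K: "summable_kernels A G"
    and sp: "series_parallel_between (\<lambda>e. {tail D e, head D e}) V E s t"
    and E: "E \<subseteq> arcs D"
  shows "\<exists>\<tau> m c. (\<forall>e\<in>E. \<tau> e = (tail D e, head D e) \<or> \<tau> e = (head D e, tail D e)) \<and>
    generates A (image_mset (\<lambda>e. graph_lattice_sum A (bridge G e (\<tau> e))) (mset_set E))
      m c {#graph_lattice_sum A (subnetwork G V E s t)#} \<and>
    m + 2 = card V \<and> c + card V = card E + 1"
proof -
  let ?M = "\<lambda>E \<tau>. image_mset (\<lambda>e. graph_lattice_sum A (bridge G e (\<tau> e))) (mset_set E)"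
  let ?O = "\<lambda>E \<tau>. \<forall>e\<in>E. \<tau> e = (tail D e, head D e) \<or> \<tau> e = (head D e, tail D e)"
  let ?Z = "\<lambda>V E s t. graph_lattice_sum A (subnetwork G V E s t)"
  have merge: "\<exists>\<tau>. ?O (E1 \<union> E2) \<tau> \<and> ?M (E1 \<union> E2) \<tau> = ?M E1 \<tau>1 + ?M E2 \<tau>2"
    if "?O E1 \<tau>1" "?O E2 \<tau>2" "finite E1" "finite E2" "E1 \<inter> E2 = {}" for E1 E2 \<tau>1 \<tau>2
  proof (intro exI conjI)
    let ?\<tau> = "\<lambda>e. if e \<in> E1 then \<tau>1 e else \<tau>2 e"
    show "?O (E1 \<union> E2) ?\<tau>"
      using that by auto
    have "?M E1 ?\<tau> = ?M E1 \<tau>1" "?M E2 ?\<tau> = ?M E2 \<tau>2"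
      using that by (auto intro!: image_mset_cong)
    then show "?M (E1 \<union> E2) ?\<tau> = ?M E1 \<tau>1 + ?M E2 \<tau>2"
      using that by (simp add: mset_set_Union)
  qed
  note summable = abs_summable_weight_series_parallel[OF K, folded D_def]
  note glue = gluing_series_parallel[of G, folded D_def]
  show ?thesis
    using sp E
  proof induction
    case (single_edge s t e)
    then have "{tail D e, head D e} = {s, t}"
      by simp
    \<comment> \<open>This is the only place where the order of the terminals of a bridge is chosen.\<close>
    then have "?O {e} (\<lambda>_. (s, t))"
      by (auto simp: doubleton_eq_iff)
    moreover have "generates A (?M {e} (\<lambda>_. (s, t))) 0 0 {#?Z {s, t} {e} s t#}"
      using single_edge by (simp add: bridge_eq_subnetwork D_def generates.start)
    ultimately show ?case
      using single_edge(1) by (intro exI[of _ "\<lambda>_. (s, t)"] exI[of _ 0]) auto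
  next
    case (series_comp V1 E1 s u V2 E2 t)
    interpret gluing A G V1 V2 E1 E2 s u
      using series_comp by (intro glue) auto
    obtain \<tau>1 m1 c1 where 1: "?O E1 \<tau>1" "generates A (?M E1 \<tau>1) m1 c1 {#?Z V1 E1 s u#}"
        "m1 + 2 = card V1" "c1 + card V1 = card E1 + 1"
      using series_comp.IH(1) series_comp.prems by auto
    obtain \<tau>2 m2 c2 where 2: "?O E2 \<tau>2" "generates A (?M E2 \<tau>2) m2 c2 {#?Z V2 E2 u t#}"
        "m2 + 2 = card V2" "c2 + card V2 = card E2 + 1"
      using series_comp.IH(2) series_comp.prems by auto
    obtain \<tau> where \<tau>: "?O (E1 \<union> E2) \<tau>" "?M (E1 \<union> E2) \<tau> = ?M E1 \<tau>1 + ?M E2 \<tau>2"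
      using merge[OF 1(1) 2(1) fin disj] by blast
    have "?Z (V1 \<union> V2) (E1 \<union> E2) s t = (\<lambda>k. ?Z V1 E1 s u k * ?Z V2 E2 u t k)"
      using series_comp series_parallel_between_terminals[OF series_comp.hyps(2)]
      by (intro graph_lattice_sum_series summable) auto
    moreover have "generates A (?M (E1 \<union> E2) \<tau>) (Suc (m1 + m2)) (c1 + c2)
        {#\<lambda>k. ?Z V1 E1 s u k * ?Z V2 E2 u t k#}"
      using generates.multiply[of A _ _ _ "{#}"] generates_union[OF 1(2) 2(2)] by (simp add: \<tau>(2))
    moreover have "Suc (m1 + m2) + 2 = card (V1 \<union> V2)"
        "c1 + c2 + card (V1 \<union> V2) = card (E1 \<union> E2) + 1"
      using 1(3,4) 2(3,4) card_Un_Int[of V1 V2] card_Un_disjoint[OF fin disj]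
        series_comp.hyps series_parallel_between_finite[OF series_comp.hyps(1)]
        series_parallel_between_finite[OF series_comp.hyps(2)]
      by auto
    ultimately show ?case
      using \<tau>(1) by (intro exI[of _ \<tau>] exI[of _ "Suc (m1 + m2)"] exI[of _ "c1 + c2"]) simp
  next
    case (parallel_comp V1 E1 s t V2 E2)
    interpret gluing A G V1 V2 E1 E2 s s
      using parallel_comp by (intro glue) auto
    obtain \<tau>1 m1 c1 where 1: "?O E1 \<tau>1" "generates A (?M E1 \<tau>1) m1 c1 {#?Z V1 E1 s t#}"
        "m1 + 2 = card V1" "c1 + card V1 = card E1 + 1"
      using parallel_comp.IH(1) parallel_comp.prems by auto
    obtain \<tau>2 m2 c2 where 2: "?O E2 \<tau>2" "generates A (?M E2 \<tau>2) m2 c2 {#?Z V2 E2 s t#}"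
        "m2 + 2 = card V2" "c2 + card V2 = card E2 + 1"
      using parallel_comp.IH(2) parallel_comp.prems by auto
    obtain \<tau> where \<tau>: "?O (E1 \<union> E2) \<tau>" "?M (E1 \<union> E2) \<tau> = ?M E1 \<tau>1 + ?M E2 \<tau>2"
      using merge[OF 1(1) 2(1) fin disj] by blast
    have st: "s \<noteq> t"
      using parallel_comp.hyps(1) series_parallel_between_terminals by fast
    have "?Z (V1 \<union> V2) (E1 \<union> E2) s t = convolution A (?Z V1 E1 s t) (?Z V2 E2 s t)"
      using parallel_comp by (intro graph_lattice_sum_parallel summable A) auto
    moreover have "generates A (?M (E1 \<union> E2) \<tau>) (m1 + m2) (Suc (c1 + c2))
        {#convolution A (?Z V1 E1 s t) (?Z V2 E2 s t)#}"
      using generates.convolve[of A _ _ _ "{#}"] generates_union[OF 1(2) 2(2)] by (simp add: \<tau>(2))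
    moreover have "m1 + m2 + 2 = card (V1 \<union> V2)"
        "Suc (c1 + c2) + card (V1 \<union> V2) = card (E1 \<union> E2) + 1"
      using 1(3,4) 2(3,4) card_Un_Int[of V1 V2] card_Un_disjoint[OF fin disj] st
        parallel_comp.hyps series_parallel_between_finite[OF parallel_comp.hyps(1)]
        series_parallel_between_finite[OF parallel_comp.hyps(2)]
      by auto
    ultimately show ?case
      using \<tau>(1) by (intro exI[of _ \<tau>] exI[of _ "m1 + m2"] exI[of _ "Suc (c1 + c2)"]) simp
  qed
qed

lemma graph_lattice_sum_whole:
  "graph_lattice_sum A (subnetwork G (verts (multigraph G)) (arcs (multigraph G)) (source G) (sink G)) =
    graph_lattice_sum A G"
  by (intro ext) (simp add: graph_lattice_sum_def pinned_lattice_sum_def subnetwork_def)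

text \<open>With equal terminals the phase is identically one, and so it is at momentum zero for any
  terminals. The two sums then differ only in the node that is pinned.\<close>

lemma graph_lattice_sum_equal_terminals:
  assumes G: "finite_network G" and st: "source G = sink G" and s: "s \<in> verts (multigraph G)"
  shows "graph_lattice_sum A G =
    zero_momentum (graph_lattice_sum A (subnetwork G (verts (multigraph G)) (arcs (multigraph G)) s t))"
proof
  fix k
  have "graph_lattice_sum A G k = pinned_lattice_sum A G s 0 k"
    by (rule graph_lattice_sum_pin[OF G s bravais_lattice_0])
  then show "graph_lattice_sum A G k =
    zero_momentum (graph_lattice_sum A (subnetwork G (verts (multigraph G)) (arcs (multigraph G)) s t)) k"
    by (simp add: zero_momentum_def graph_lattice_sum_def pinned_lattice_sum_def subnetwork_def st)
qed

theorem theorem5p7: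
  fixes A :: "real^'n^'n" and G :: "('v, 'e, 'n::finite) network"
  assumes "invertible A"
    and "finite_network G"
    and "summable_kernels A G"
    and "series_parallel G"
  shows "\<exists>\<tau> m c f.
    (\<forall>e\<in>arcs (multigraph G).
       \<tau> e = (tail (multigraph G) e, head (multigraph G) e) \<or>
       \<tau> e = (head (multigraph G) e, tail (multigraph G) e)) \<and>
    generates A
      (image_mset (\<lambda>e. graph_lattice_sum A (bridge G e (\<tau> e))) (mset_set (arcs (multigraph G))))
      m c {#f#} \<and>
    int m = int (card (verts (multigraph G))) - 2 \<and>
    int c = int (card (arcs (multigraph G))) - int (card (verts (multigraph G))) + 1 \<and>
    int (m + c) = int (card (arcs (multigraph G))) - 1 \<and>
    graph_lattice_sum A G = (if source G = sink G then zero_momentum f else f)"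
proof -
  let ?D = "multigraph G"
  let ?Z = "\<lambda>s t. graph_lattice_sum A (subnetwork G (verts ?D) (arcs ?D) s t)"
  obtain s t where
    sp: "series_parallel_between (\<lambda>e. {tail ?D e, head ?D e}) (verts ?D) (arcs ?D) s t"
    and Z: "graph_lattice_sum A G = (if source G = sink G then zero_momentum (?Z s t) else ?Z s t)"
  proof (cases "source G = sink G")
    case True
    then obtain s t where "s \<in> verts ?D"
      "series_parallel_between (\<lambda>e. {tail ?D e, head ?D e}) (verts ?D) (arcs ?D) s t"
      using assms(4) by (auto simp: series_parallel_def Let_def)
    with True show ?thesis
      using graph_lattice_sum_equal_terminals[OF assms(2)] by (intro that[of s t]) auto
  next
    case False
    then show ?thesis
      using assms(4) by (intro that[of "source G" "sink G"])
        (auto simp: series_parallel_def Let_def graph_lattice_sum_whole)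
  qed
  obtain \<tau> m c where "\<forall>e\<in>arcs ?D. \<tau> e = (tail ?D e, head ?D e) \<or> \<tau> e = (head ?D e, tail ?D e)"
    and "generates A (image_mset (\<lambda>e. graph_lattice_sum A (bridge G e (\<tau> e))) (mset_set (arcs ?D)))
      m c {#?Z s t#}"
    and "m + 2 = card (verts ?D)" "c + card (verts ?D) = card (arcs ?D) + 1"
    using generates_series_parallel[OF assms(1,3) sp] by auto
  with Z show ?thesis
    by (intro exI[of _ \<tau>] exI[of _ m] exI[of _ c] exI[of _ "?Z s t"]) auto
qed

end
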